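(* Let $V_1\in\mathbf{Gr}(A)$. For all $(W_1,V_2,W_2)\in\mathbf{Gr}(A)^3$ such that $((V_1,W_1),(V_2,W_2))\in\mathrm{Adm}(A)$, the operator $\Xi((V_1,W_1),(V_2,W_2))$ defines a diffeomorphism of $\mathbf{Gr}_{V_1}(A)$ by $$W\in\mathbf{Gr}_{V_1}(A)\mapsto\Xi((V_1,W_1),(V_2,W_2))(W).$$ Moreover, setting $$D_{V_1}=\{(W_1,V_2,W_2)\in\mathbf{Gr}(A)^3\;|\;((V_1,W_1),(V_2,W_2))\in\mathrm{Adm}(A)\},$$ the map $$(W_1,V_2,W_2)\in D_{V_1}\mapsto\Xi((V_1,W_1),(V_2,W_2))\in\mathrm{Diff}(\mathbf{Gr}_{V_1}(A))$$ is smooth.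
   Context: A map between diffeological spaces is smooth if it sends plots to plots by composition. Subsets carry the subset diffeology, products the product diffeology. For a diffeological space $X$, $C^\infty(X,X)$ has the functional diffeology ($\rho:O\to C^\infty(X,X)$ is a plot iff for every plot $c$ of $X$ the map $(x,y)\mapsto\rho(y)(c(x))$ is a plot of $X$), and $\mathrm{Diff}(X)$ is the group of smooth bijections with smooth inverse, with plots the maps $g:O\to\mathrm{Diff}(X)$ such that $g$ and $y\mapsto g(y)^{-1}$ are both plots of $C^\infty(X,X)$. Vector spaces and algebras are over $\mathbb{R}$ or $\mathbb{C}$; a diffeological vector space (resp. algebra) is one whose operations are smooth. Let $E$ be a diffeological vector space, $L(E)$ its smooth linear endomorphisms with the functional diffeology, and $A$ a unital diffeological algebra acting smoothly on $E$ (e.g. $A=L(E)$). Let $\mathbf{P}(A)=\{p\in A: p^2=p\}$ with the subset diffeology. $\mathbf{Spl}(A)$ is the set of pairs $(V,W)$ of linear subspaces of $E$ such that $V=\mathrm{Im}(p)$, $W=\mathrm{Ker}(p)$ for some $p\in\mathbf{P}(A)$, with the push-forward diffeology under $p\mapsto(\mathrm{Im}\,p,\mathrm{Ker}\,p)$ (plots are locally images of plots of $\mathbf{P}(A)$). The Grassmannian $\mathbf{Gr}(A)$ is the set of subspaces $\mathrm{Im}(p)$, $p\in\mathbf{P}(A)$, with the push-forward diffeology under $p\mapsto\mathrm{Im}\,p$. Let $\pi_1:\mathbf{Spl}(A)\to\mathbf{Gr}(A)$, $\pi_1(V,W)=V$. For $V_1\in\mathbf{Gr}(A)$, the Grassmannian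 relative to $V_1$ is $\mathbf{Gr}_{V_1}(A)=\pi_1^{-1}(V_1)=\{W\in\mathbf{Gr}(A): (V_1,W)\in\mathbf{Spl}(A)\}$, with the diffeology induced by $\mathbf{Spl}(A)$ via $W\mapsto(V_1,W)$. For $(V,W)\in\mathbf{Spl}(A)$, $p_{(V,W)}\in L(E)$ is the projection onto $V$ parallel to $W$. A couple $((V_1,W_1),(V_2,W_2))\in\mathbf{Spl}(A)^2$ is admissible if $((V_1,W_2),(V_2,W_1))\in\mathbf{Spl}(A)^2$. The set of admissible couples is $\mathrm{Adm}(A)$, with the subset diffeology of $\mathbf{Spl}(A)^2$; $D_{V_1}$ carries the diffeology induced from $\mathrm{Adm}(A)$ via $(W_1,V_2,W_2)\mapsto((V_1,W_1),(V_2,W_2))$. Put $$DV(V_1,W_1,V_2,W_2)=p_{(V_1,W_2)}\circ p_{(V_2,W_1)}|_{V_1},\qquad \Phi((V_1,W_1),(V_2,W_2))=DV(V_1,W_1,V_2,W_2)\circ p_{(V_1,W_1)}\in L(E),$$ $$\tilde{DV}((V_1,W_1),(V_2,W_2))=\Phi((V_1,W_1),(V_2,W_2))+\Phi((W_1,V_1),(W_2,V_2)),$$ $$\Xi((V_1,W_1),(V_2,W_2))=\tilde{DV}((V_1,W_1),(V_2,W_2))\circ\tilde{DV}((V_1,W_2),(V_2,W_1)).$$ *)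

theory Defs
  imports "HOL-Analysis.Analysis" "HOL-Algebra.Module"
begin

section \<open>Smooth maps on open subsets of finite-dimensional real spaces\<close>

text \<open>
  The dimension of the domain of a plot varies, so the space of dimension \<open>n\<close> is
  \<^const>\<open>Euclidean_space\<close> \<open>n\<close>: sequences of reals vanishing from index \<open>n\<close> on.
  \<open>Ck_on n k U f\<close> is meant for \<open>U\<close> open in \<^const>\<open>Euclidean_space\<close> \<open>n\<close>; it says that all
  partial derivatives of \<open>f\<close> up to order \<open>k\<close> exist and are continuous on \<open>U\<close>.
\<close>

primrec Ck_on ::
  "nat \<Rightarrow> nat \<Rightarrow> (nat \<Rightarrow> real) set \<Rightarrow> ((nat \<Rightarrow> real) \<Rightarrow> 'b::real_normed_vector) \<Rightarrow> bool" where
  "Ck_on n 0 U f \<longleftrightarrow> continuous_map (subtopology (Euclidean_space n) U) euclidean f"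
| "Ck_on n (Suc k) U f \<longleftrightarrow>
     continuous_map (subtopology (Euclidean_space n) U) euclidean f \<and>
     (\<forall>i<n. \<exists>g. (\<forall>x\<in>U. ((\<lambda>t. f (x(i := t))) has_vector_derivative g x) (at (x i))) \<and>
                Ck_on n k U g)"

definition smooth_on ::
  "nat \<Rightarrow> (nat \<Rightarrow> real) set \<Rightarrow> ((nat \<Rightarrow> real) \<Rightarrow> 'b::real_normed_vector) \<Rightarrow> bool" where
  "smooth_on n U f \<longleftrightarrow> (\<forall>k. Ck_on n k U f)"

definition smooth_between ::
  "nat \<Rightarrow> (nat \<Rightarrow> real) set \<Rightarrow> nat \<Rightarrow> (nat \<Rightarrow> real) set \<Rightarrow> ((nat \<Rightarrow> real) \<Rightarrow> nat \<Rightarrow> real) \<Rightarrow> bool"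
  where
  "smooth_between n U m V \<phi> \<longleftrightarrow> \<phi> ` U \<subseteq> V \<and> (\<forall>j<m. smooth_on n U (\<lambda>x. \<phi> x j))"

text \<open>
  Identification of the space of dimension \<open>m + n\<close> with the product of those of dimensions
  \<open>m\<close> and \<open>n\<close>, by concatenation of coordinates.
\<close>

definition fst_part :: "nat \<Rightarrow> (nat \<Rightarrow> real) \<Rightarrow> nat \<Rightarrow> real" where
  "fst_part m z = (\<lambda>i. if i < m then z i else 0)"

definition snd_part :: "nat \<Rightarrow> (nat \<Rightarrow> real) \<Rightarrow> nat \<Rightarrow> real" where
  "snd_part m z = (\<lambda>i. z (m + i))"

definition prod_domain ::
  "nat \<Rightarrow> (nat \<Rightarrow> real) set \<Rightarrow> nat \<Rightarrow> (nat \<Rightarrow> real) set \<Rightarrow> (nat \<Rightarrow> real) set" where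
  "prod_domain m U n V =
     {z \<in> topspace (Euclidean_space (m + n)). fst_part m z \<in> U \<and> snd_part m z \<in> V}"


section \<open>Diffeological spaces\<close>

text \<open>
  \<open>plot X n U f\<close>: the restriction of \<open>f\<close> to the open subset \<open>U\<close> of the \<open>n\<close>-dimensional space
  is a plot of \<open>X\<close>. Values of \<open>f\<close> outside \<open>U\<close> are irrelevant, by \<open>plot_local\<close>.
\<close>

record 'a diffeology =
  points :: "'a set"
  plot :: "nat \<Rightarrow> (nat \<Rightarrow> real) set \<Rightarrow> ((nat \<Rightarrow> real) \<Rightarrow> 'a) \<Rightarrow> bool"

locale diffeological_space =
  fixes X :: "'a diffeology"
  assumes plot_domain: "plot X n U f \<Longrightarrow> openin (Euclidean_space n) U"
    and plot_into: "plot X n U f \<Longrightarrow> f ` U \<subseteq> points X"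
    and plot_const:
      "openin (Euclidean_space n) U \<Longrightarrow> x \<in> points X \<Longrightarrow> plot X n U (\<lambda>_. x)"
    and plot_local:
      "openin (Euclidean_space n) U \<Longrightarrow>
       (\<And>u. u \<in> U \<Longrightarrow> \<exists>U' g. u \<in> U' \<and> U' \<subseteq> U \<and> plot X n U' g \<and> (\<forall>v\<in>U'. f v = g v)) \<Longrightarrow>
       plot X n U f"
    and plot_compose:
      "plot X n U f \<Longrightarrow> openin (Euclidean_space m) V \<Longrightarrow> smooth_between m V n U \<phi> \<Longrightarrow>
       plot X m V (f \<circ> \<phi>)"

definition smooth :: "'a diffeology \<Rightarrow> 'b diffeology \<Rightarrow> ('a \<Rightarrow> 'b) \<Rightarrow> bool" where
  "smooth X Y f \<longleftrightarrow>
     f ` points X \<subseteq> points Y \<and> (\<forall>n U c. plot X n U c \<longrightarrow> plot Y n U (f \<circ> c))"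

definition diffeomorphism :: "'a diffeology \<Rightarrow> 'b diffeology \<Rightarrow> ('a \<Rightarrow> 'b) \<Rightarrow> bool" where
  "diffeomorphism X Y f \<longleftrightarrow>
     bij_betw f (points X) (points Y) \<and> smooth X Y f \<and> smooth Y X (inv_into (points X) f)"

definition standard_diff :: "'b::real_normed_vector diffeology" where
  "standard_diff =
     \<lparr>points = UNIV, plot = (\<lambda>n U f. openin (Euclidean_space n) U \<and> smooth_on n U f)\<rparr>"

definition prod_diff :: "'a diffeology \<Rightarrow> 'b diffeology \<Rightarrow> ('a \<times> 'b) diffeology" where
  "prod_diff X Y =
     \<lparr>points = points X \<times> points Y,
      plot = (\<lambda>n U f. plot X n U (fst \<circ> f) \<and> plot Y n U (snd \<circ> f))\<rparr>"

text \<open>The diffeology induced on the set \<open>S\<close> by a map \<open>\<phi>\<close> from \<open>S\<close> to \<open>X\<close>.\<close>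

definition induced_diff :: "'s set \<Rightarrow> ('s \<Rightarrow> 'a) \<Rightarrow> 'a diffeology \<Rightarrow> 's diffeology" where
  "induced_diff S \<phi> X =
     \<lparr>points = S, plot = (\<lambda>n U f. f ` U \<subseteq> S \<and> plot X n U (\<phi> \<circ> f))\<rparr>"

definition subset_diff :: "'a set \<Rightarrow> 'a diffeology \<Rightarrow> 'a diffeology" where
  "subset_diff S X = induced_diff S (\<lambda>x. x) X"

text \<open>The push-forward diffeology on the image of \<open>X\<close> under \<open>\<pi>\<close>.\<close>

definition pushforward_diff :: "('a \<Rightarrow> 'b) \<Rightarrow> 'a diffeology \<Rightarrow> 'b diffeology" where
  "pushforward_diff \<pi> X =
     \<lparr>points = \<pi> ` points X,
      plot = (\<lambda>n U f. openin (Euclidean_space n) U \<and>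
        (\<forall>u\<in>U. \<exists>U' g. u \<in> U' \<and> U' \<subseteq> U \<and> plot X n U' g \<and> (\<forall>v\<in>U'. f v = \<pi> (g v))))\<rparr>"

text \<open>
  Functional diffeology. Maps with domain \<^term>\<open>points X\<close> are represented by functions
  that are \<^const>\<open>undefined\<close> elsewhere, so that equality of functions is equality of maps.
\<close>

definition functional_diff :: "'a diffeology \<Rightarrow> 'b diffeology \<Rightarrow> ('a \<Rightarrow> 'b) diffeology" where
  "functional_diff X Y =
     \<lparr>points = {f \<in> extensional (points X). smooth X Y f},
      plot = (\<lambda>n U \<rho>. openin (Euclidean_space n) U \<and>
        \<rho> ` U \<subseteq> {f \<in> extensional (points X). smooth X Y f} \<and>
        (\<forall>m V c. plot X m V c \<longrightarrow>
           plot Y (m + n) (prod_domain m V n U) (\<lambda>z. \<rho> (snd_part m z) (c (fst_part m z)))))\<rparr>"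

definition Diff :: "'a diffeology \<Rightarrow> ('a \<Rightarrow> 'a) diffeology" where
  "Diff X =
     \<lparr>points = {f \<in> extensional (points X). diffeomorphism X X f},
      plot = (\<lambda>n U g. g ` U \<subseteq> {f \<in> extensional (points X). diffeomorphism X X f} \<and>
        plot (functional_diff X X) n U g \<and>
        plot (functional_diff X X) n U
          (\<lambda>y. restrict (inv_into (points X) (g y)) (points X)))\<rparr>"


section \<open>Diffeological vector spaces, algebras and actions\<close>

text \<open>
  Scalars: up to isomorphism, the instances of \<^class>\<open>real_normed_field\<close> are exactly the
  field of real numbers and the field of complex numbers, with their usual absolute values
  (Gelfand--Mazur), so generality over this class means ``over the reals or the complex numbers''.
\<close>

locale diffeological_vector_space =
  vector_space scale + diffeological_space E
  for scale :: "'k::real_normed_field \<Rightarrow> 'e::ab_group_add \<Rightarrow> 'e" and E :: "'e diffeology" +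
  assumes points_UNIV: "points E = UNIV"
    and add_smooth: "smooth (prod_diff E E) E (\<lambda>(x, y). x + y)"
    and scale_smooth: "smooth (prod_diff standard_diff E) E (\<lambda>(c, x). scale c x)"

definition scalar_ring :: "'k::field ring" where
  "scalar_ring = \<lparr>carrier = UNIV, mult = (*), one = 1, zero = 0, add = (+)\<rparr>"

text \<open>
  Algebras are associative and unital, not necessarily commutative, which rules out the locale
  \<^locale>\<open>algebra\<close>. They live on a carrier set so that sets of endomorphisms of a diffeological
  vector space are admitted.
\<close>

locale diffeological_algebra =
  diffeological_space DA
  for A :: "('k::real_normed_field, 'a) module" and DA :: "'a diffeology" +
  assumes points_carrier: "points DA = carrier A"
    and algebra_ring: "ring A"
    and algebra_module: "Module.module scalar_ring A"
    and smult_mult_left: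
      "\<lbrakk>a \<in> carrier A; b \<in> carrier A\<rbrakk> \<Longrightarrow> (c \<odot>\<^bsub>A\<^esub> a) \<otimes>\<^bsub>A\<^esub> b = c \<odot>\<^bsub>A\<^esub> (a \<otimes>\<^bsub>A\<^esub> b)"
    and smult_mult_right:
      "\<lbrakk>a \<in> carrier A; b \<in> carrier A\<rbrakk> \<Longrightarrow> a \<otimes>\<^bsub>A\<^esub> (c \<odot>\<^bsub>A\<^esub> b) = c \<odot>\<^bsub>A\<^esub> (a \<otimes>\<^bsub>A\<^esub> b)"
    and algebra_add_smooth: "smooth (prod_diff DA DA) DA (\<lambda>(a, b). a \<oplus>\<^bsub>A\<^esub> b)"
    and algebra_mult_smooth: "smooth (prod_diff DA DA) DA (\<lambda>(a, b). a \<otimes>\<^bsub>A\<^esub> b)"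
    and algebra_smult_smooth: "smooth (prod_diff standard_diff DA) DA (\<lambda>(c, a). c \<odot>\<^bsub>A\<^esub> a)"

locale diffeological_algebra_action =
  vec: diffeological_vector_space scale E + alg: diffeological_algebra A DA
  for scale :: "'k::real_normed_field \<Rightarrow> 'e::ab_group_add \<Rightarrow> 'e"
    and E :: "'e diffeology"
    and A :: "('k, 'a) module"
    and DA :: "'a diffeology"
    and act :: "'a \<Rightarrow> 'e \<Rightarrow> 'e" +
  assumes act_linear: "a \<in> carrier A \<Longrightarrow> Vector_Spaces.linear scale scale (act a)"
    and act_add: "\<lbrakk>a \<in> carrier A; b \<in> carrier A\<rbrakk> \<Longrightarrow> act (a \<oplus>\<^bsub>A\<^esub> b) x = act a x + act b x"
    and act_smult: "a \<in> carrier A \<Longrightarrow> act (c \<odot>\<^bsub>A\<^esub> a) x = scale c (act a x)"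
    and act_mult: "\<lbrakk>a \<in> carrier A; b \<in> carrier A\<rbrakk> \<Longrightarrow> act (a \<otimes>\<^bsub>A\<^esub> b) x = act a (act b x)"
    and act_one: "act \<one>\<^bsub>A\<^esub> x = x"
    and act_smooth: "smooth (prod_diff DA E) E (\<lambda>(a, x). act a x)"


section \<open>Idempotents, splittings and Grassmannians\<close>

definition Im_act :: "('a \<Rightarrow> 'e \<Rightarrow> 'e) \<Rightarrow> 'a \<Rightarrow> 'e set" where
  "Im_act act p = range (act p)"

definition Ker_act :: "('a \<Rightarrow> 'e \<Rightarrow> 'e::zero) \<Rightarrow> 'a \<Rightarrow> 'e set" where
  "Ker_act act p = {x. act p x = 0}"

definition PA :: "('k, 'a) module \<Rightarrow> 'a diffeology \<Rightarrow> 'a diffeology" where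
  "PA A DA = subset_diff {p \<in> carrier A. p \<otimes>\<^bsub>A\<^esub> p = p} DA"

definition Spl ::
  "('k, 'a) module \<Rightarrow> 'a diffeology \<Rightarrow> ('a \<Rightarrow> 'e \<Rightarrow> 'e::zero) \<Rightarrow> ('e set \<times> 'e set) diffeology" where
  "Spl A DA act = pushforward_diff (\<lambda>p. (Im_act act p, Ker_act act p)) (PA A DA)"

definition Gr ::
  "('k, 'a) module \<Rightarrow> 'a diffeology \<Rightarrow> ('a \<Rightarrow> 'e \<Rightarrow> 'e) \<Rightarrow> 'e set diffeology" where
  "Gr A DA act = pushforward_diff (Im_act act) (PA A DA)"

definition Gr_rel ::
  "('k, 'a) module \<Rightarrow> 'a diffeology \<Rightarrow> ('a \<Rightarrow> 'e \<Rightarrow> 'e::zero) \<Rightarrow> 'e set \<Rightarrow> 'e set diffeology" where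
  "Gr_rel A DA act V1 =
     induced_diff {W \<in> points (Gr A DA act). (V1, W) \<in> points (Spl A DA act)}
       (\<lambda>W. (V1, W)) (Spl A DA act)"

definition Adm ::
  "('k, 'a) module \<Rightarrow> 'a diffeology \<Rightarrow> ('a \<Rightarrow> 'e \<Rightarrow> 'e::zero) \<Rightarrow>
   (('e set \<times> 'e set) \<times> ('e set \<times> 'e set)) diffeology" where
  "Adm A DA act =
     (let S2 = prod_diff (Spl A DA act) (Spl A DA act)
      in subset_diff
           {((V1, W1), (V2, W2)) | V1 W1 V2 W2.
              ((V1, W1), (V2, W2)) \<in> points S2 \<and> ((V1, W2), (V2, W1)) \<in> points S2} S2)"

definition D_rel ::
  "('k, 'a) module \<Rightarrow> 'a diffeology \<Rightarrow> ('a \<Rightarrow> 'e \<Rightarrow> 'e::zero) \<Rightarrow> 'e set \<Rightarrow>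
   ('e set \<times> 'e set \<times> 'e set) diffeology" where
  "D_rel A DA act V1 =
     induced_diff
       {(W1, V2, W2) | W1 V2 W2.
          W1 \<in> points (Gr A DA act) \<and> V2 \<in> points (Gr A DA act) \<and> W2 \<in> points (Gr A DA act) \<and>
          ((V1, W1), (V2, W2)) \<in> points (Adm A DA act)}
       (\<lambda>(W1, V2, W2). ((V1, W1), (V2, W2))) (Adm A DA act)"


section \<open>The operators built from pairs of splittings\<close>

text \<open>The projection onto \<open>V\<close> parallel to \<open>W\<close>, meaningful when \<open>E\<close> is the direct sum of both.\<close>

definition proj :: "'e::ab_group_add set \<times> 'e set \<Rightarrow> 'e \<Rightarrow> 'e" where
  "proj = (\<lambda>(V, W) x. THE v. v \<in> V \<and> (\<exists>w\<in>W. x = v + w))"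

definition DV ::
  "'e::ab_group_add set \<Rightarrow> 'e set \<Rightarrow> 'e set \<Rightarrow> 'e set \<Rightarrow> 'e \<Rightarrow> 'e" where
  "DV V1 W1 V2 W2 = restrict (proj (V1, W2) \<circ> proj (V2, W1)) V1"

definition Phi ::
  "('e::ab_group_add set \<times> 'e set) \<times> ('e set \<times> 'e set) \<Rightarrow> 'e \<Rightarrow> 'e" where
  "Phi = (\<lambda>((V1, W1), (V2, W2)). DV V1 W1 V2 W2 \<circ> proj (V1, W1))"

definition DVtilde ::
  "('e::ab_group_add set \<times> 'e set) \<times> ('e set \<times> 'e set) \<Rightarrow> 'e \<Rightarrow> 'e" where
  "DVtilde = (\<lambda>((V1, W1), (V2, W2)) x.
     Phi ((V1, W1), (V2, W2)) x + Phi ((W1, V1), (W2, V2)) x)"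

definition Xi ::
  "('e::ab_group_add set \<times> 'e set) \<times> ('e set \<times> 'e set) \<Rightarrow> 'e \<Rightarrow> 'e" where
  "Xi = (\<lambda>((V1, W1), (V2, W2)).
     DVtilde ((V1, W1), (V2, W2)) \<circ> DVtilde ((V1, W2), (V2, W1)))"

end

theory Submission
  imports Defs
begin

text \<open>
  The theorem holds for a drastic reason: for every admissible couple the operator \<open>\<Xi>\<close> is the
  identity of \<open>E\<close> (\<open>Xi_eq_id\<close>).

  Write \<open>a\<close>, \<open>b\<close>, \<open>c\<close>, \<open>d\<close> for the projections attached to the splittings \<open>(V1, W1)\<close>,
  \<open>(V1, W2)\<close>, \<open>(V2, W1)\<close>, \<open>(V2, W2)\<close>. Projections with a common image satisfy \<open>ab = b\<close>, \<open>ba = a\<close>,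
  \<open>dc = c\<close>, \<open>cd = d\<close>, and those with a common kernel \<open>ac = a\<close>, \<open>ca = c\<close>, \<open>bd = b\<close>, \<open>db = d\<close>. With these
  relations the first factor of \<open>\<Xi>\<close> simplifies to \<open>1 - (b - c)\<^sup>2\<close>
  (\<open>DVtilde_eq_one_minus_square\<close>); exchanging \<open>W1\<close> and \<open>W2\<close>, the second one is \<open>1 - (a - d)\<^sup>2\<close>.

  These operators are inverse to each other. On \<open>V1\<close> the first is \<open>bc\<close>: go to \<open>V2\<close> along \<open>W1\<close> and
  come back to \<open>V1\<close> along \<open>W2\<close>. The second is \<open>ad\<close> there: go to \<open>V2\<close> along \<open>W2\<close> and come back along
  \<open>W1\<close>, the same way in the opposite direction. The second operator commutes with \<open>a\<close> and \<open>d\<close>,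
  hence preserves \<open>W1\<close> too, although its definition refers to the decomposition of \<open>E\<close> as the
  sum of \<open>V1\<close> and \<open>W2\<close>; on \<open>W1\<close> the two operators travel in opposite directions between \<open>W1\<close> and
  \<open>W2\<close>.

  What remains is diffeology: on any diffeological space \<open>X\<close> the identity is a diffeomorphism,
  and a constant family at the identity is a plot of \<open>Diff X\<close> (\<open>plot_Diff_const_id\<close>). For this
  the relative Grassmannian has to satisfy the axioms of a diffeological space, which pass from
  \<open>A\<close> to push-forward and induced diffeologies.
\<close>

section \<open>Smooth maps between open subsets of Euclidean spaces\<close>

lemma Ck_on_const: "Ck_on n k U (\<lambda>_. c)"
proof (induction k arbitrary: c)
  case (Suc k)
  have "\<forall>x\<in>U. ((\<lambda>t. c) has_vector_derivative 0) (at (x i))" for i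
    by simp
  then show ?case
    using Suc[of 0] by (auto intro!: exI[of _ "\<lambda>_. 0"])
qed simp

lemma continuous_map_coordinate:
  "continuous_map (subtopology (Euclidean_space n) U) euclideanreal (\<lambda>x. x j)"
  unfolding Euclidean_space_def
  by (intro continuous_map_from_subtopology continuous_map_product_projection) auto

lemma smooth_on_coordinate: "smooth_on n U (\<lambda>x. x j)"
  unfolding smooth_on_def
proof
  fix k
  show "Ck_on n k U (\<lambda>x. x j)"
  proof (cases k)
    case 0
    then show ?thesis by (simp add: continuous_map_coordinate)
  next
    case (Suc l)
    have "\<exists>g. (\<forall>x\<in>U. ((\<lambda>t. (x(i := t)) j) has_vector_derivative g x) (at (x i))) \<and>
              Ck_on n l U g" for i
      by (rule exI[of _ "\<lambda>_. if i = j then 1 else 0"])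
        (auto simp: Ck_on_const)
    then show ?thesis
      unfolding Suc Ck_on.simps using continuous_map_coordinate by blast
  qed
qed

lemma Ck_on_subset: "Ck_on n k U f \<Longrightarrow> U' \<subseteq> U \<Longrightarrow> Ck_on n k U' f"
proof (induction k arbitrary: f)
  case 0
  then show ?case by (auto intro: continuous_map_from_subtopology_mono)
next
  case (Suc k)
  then show ?case
    by (simp, meson continuous_map_from_subtopology_mono subsetD)
qed

lemma smooth_on_subset: "smooth_on n U f \<Longrightarrow> U' \<subseteq> U \<Longrightarrow> smooth_on n U' f"
  by (auto simp: smooth_on_def intro: Ck_on_subset)

text \<open>
  Only the coordinates below \<open>n\<close> are controlled by a hypothesis; the others vanish on the image.
\<close>

lemma continuous_map_into_Euclidean_space:
  assumes "\<phi> ` topspace X \<subseteq> topspace (Euclidean_space n)"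
    and "\<And>j. j < n \<Longrightarrow> continuous_map X euclideanreal (\<lambda>x. \<phi> x j)"
  shows "continuous_map X (Euclidean_space n) \<phi>"
proof -
  have "continuous_map X euclideanreal (\<lambda>x. \<phi> x j)" for j
  proof (cases "j < n")
    case False
    then have zero: "0 = \<phi> x j" if "x \<in> topspace X" for x
      using assms(1) that by (auto simp: topspace_Euclidean_space)
    have "continuous_map X euclideanreal (\<lambda>_. 0)"
      by simp
    then show ?thesis
      using zero by (rule continuous_map_eq)
  qed (use assms(2) in auto)
  moreover have "\<phi> \<in> topspace X \<rightarrow> {x. \<forall>i\<ge>n. x i = 0}"
    using assms(1) by (auto simp: topspace_Euclidean_space)
  ultimately show ?thesis
    unfolding Euclidean_space_def
    by (auto simp: continuous_map_in_subtopology continuous_map_componentwise_UNIV)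
qed

lemma openin_smooth_vimage:
  assumes "smooth_between m V n U \<phi>" "openin (Euclidean_space m) V"
    and "openin (Euclidean_space n) U" "openin (Euclidean_space n) U'"
  shows "openin (Euclidean_space m) {v \<in> V. \<phi> v \<in> U'}"
proof -
  have top: "topspace (subtopology (Euclidean_space m) V) = V"
    using openin_subset[OF assms(2)] by (auto simp: topspace_subtopology)
  have "continuous_map (subtopology (Euclidean_space m) V) euclideanreal (\<lambda>x. \<phi> x j)"
    if "j < n" for j
  proof -
    have "Ck_on m 0 V (\<lambda>x. \<phi> x j)"
      using assms(1) that unfolding smooth_between_def smooth_on_def by blast
    then show ?thesis by simp
  qed
  then have "continuous_map (subtopology (Euclidean_space m) V) (Euclidean_space n) \<phi>"
    using assms(1) openin_subset[OF assms(3)] top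
    by (intro continuous_map_into_Euclidean_space) (auto simp: smooth_between_def)
  from openin_continuous_map_preimage[OF this assms(4)]
  have open_preimage: "openin (subtopology (Euclidean_space m) V)
      {v \<in> topspace (subtopology (Euclidean_space m) V). \<phi> v \<in> U'}" .
  have "openin (Euclidean_space m) {v \<in> topspace (subtopology (Euclidean_space m) V). \<phi> v \<in> U'}"
    using open_preimage assms(2) by (rule openin_trans_full)
  then show ?thesis
    unfolding top .
qed

lemma openin_prod_domain:
  assumes "openin (Euclidean_space m) U" "openin (Euclidean_space n) V"
  shows "openin (Euclidean_space (m + n)) (prod_domain m U n V)"
proof -
  have coord: "continuous_map (Euclidean_space (m + n)) euclideanreal (\<lambda>x. x j)" for j
    using continuous_map_coordinate[of "m + n" UNIV j] by simp
  have "continuous_map (Euclidean_space (m + n)) (Euclidean_space m) (fst_part m)"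
    by (rule continuous_map_into_Euclidean_space)
      (auto simp: topspace_Euclidean_space fst_part_def coord)
  from openin_continuous_map_preimage[OF this assms(1)]
  have 1: "openin (Euclidean_space (m + n)) {z \<in> topspace (Euclidean_space (m + n)). fst_part m z \<in> U}" .
  have "continuous_map (Euclidean_space (m + n)) (Euclidean_space n) (snd_part m)"
    by (rule continuous_map_into_Euclidean_space)
      (auto simp: topspace_Euclidean_space snd_part_def coord)
  from openin_continuous_map_preimage[OF this assms(2)]
  have 2: "openin (Euclidean_space (m + n)) {z \<in> topspace (Euclidean_space (m + n)). snd_part m z \<in> V}" .
  show ?thesis
    using openin_Int[OF 1 2] unfolding prod_domain_def
    by (rule back_subst[of "openin _"]) auto
qed

text \<open>
  The functional diffeology is tested on products of domains; this makes the first factor of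
  such a product available for precomposition.
\<close>

lemma smooth_between_fst_part:
  "smooth_between (m + n) (prod_domain m U n V) m U (fst_part m)"
  by (auto simp: smooth_between_def prod_domain_def fst_part_def smooth_on_coordinate)


section \<open>Induced and push-forward diffeologies\<close>

lemma (in diffeological_space) plot_cong:
  assumes "plot X n U g" "\<And>u. u \<in> U \<Longrightarrow> f u = g u"
  shows "plot X n U f"
proof (rule plot_local)
  show "openin (Euclidean_space n) U"
    using assms(1) by (rule plot_domain)
  show "\<exists>U' g. u \<in> U' \<and> U' \<subseteq> U \<and> plot X n U' g \<and> (\<forall>v\<in>U'. f v = g v)" if "u \<in> U" for u
    using that assms by (intro exI[of _ U] exI[of _ g]) simp
qed

lemma diffeological_space_induced_diff:
  assumes "diffeological_space X" "\<phi> ` S \<subseteq> points X"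
  shows "diffeological_space (induced_diff S \<phi> X)"
proof -
  interpret diffeological_space X by fact
  show ?thesis
  proof (unfold_locales, goal_cases)
    case (1 n U f)
    then show ?case
      using plot_domain[of n U "\<phi> \<circ> f"] by (simp add: induced_diff_def)
  next
    case (2 n U f)
    then show ?case by (simp add: induced_diff_def)
  next
    case (3 n U x)
    then have "plot X n U (\<lambda>_. \<phi> x)"
      using assms(2) by (intro plot_const) (auto simp: induced_diff_def)
    with 3 show ?case
      by (auto simp: induced_diff_def comp_def)
  next
    case (4 n U f)
    have lift: "\<exists>U' g. u \<in> U' \<and> U' \<subseteq> U \<and> g ` U' \<subseteq> S \<and> plot X n U' (\<phi> \<circ> g) \<and> (\<forall>v\<in>U'. f v = g v)"
      if "u \<in> U" for u
      using 4(2)[OF that] unfolding induced_diff_def by simp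
    have "\<exists>U' g. u \<in> U' \<and> U' \<subseteq> U \<and> plot X n U' g \<and> (\<forall>v\<in>U'. (\<phi> \<circ> f) v = g v)"
      if u: "u \<in> U" for u
    proof -
      from lift[OF u] obtain U' g
        where "u \<in> U'" "U' \<subseteq> U" "plot X n U' (\<phi> \<circ> g)" "\<forall>v\<in>U'. f v = g v"
        by blast
      then show ?thesis
        by (intro exI[of _ U'] exI[of _ "\<phi> \<circ> g"]) simp
    qed
    then have "plot X n U (\<phi> \<circ> f)"
      by (rule plot_local[OF 4(1)])
    moreover have "f u \<in> S" if u: "u \<in> U" for u
    proof -
      from lift[OF u] obtain U' g where "u \<in> U'" "g ` U' \<subseteq> S" "\<forall>v\<in>U'. f v = g v"
        by blast
      then show ?thesis by auto
    qed
    ultimately show ?case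
      by (auto simp: induced_diff_def)
  next
    case (5 n U f m V \<psi>)
    then have "plot X m V ((\<phi> \<circ> f) \<circ> \<psi>)"
      by (intro plot_compose[of n U]) (simp_all add: induced_diff_def)
    moreover have "(f \<circ> \<psi>) ` V \<subseteq> S"
      using 5 by (auto simp: induced_diff_def smooth_between_def)
    ultimately show ?case
      by (simp add: induced_diff_def comp_assoc)
  qed
qed

text \<open>
  A plot of the push-forward has lifts only locally. Stability under precomposition therefore
  needs continuity of the reparametrization: the preimage of the domain of a lift must be open,
  so that the composite lifts over it.
\<close>

lemma diffeological_space_pushforward_diff:
  assumes "diffeological_space X"
  shows "diffeological_space (pushforward_diff \<pi> X)"
proof -
  interpret diffeological_space X by fact
  show ?thesis
  proof (unfold_locales, goal_cases)
    case (1 n U f)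
    then show ?case by (simp add: pushforward_diff_def)
  next
    case (2 n U f)
    then show ?case
      using plot_into by (fastforce simp: pushforward_diff_def)
  next
    case (3 n U x)
    then obtain y where "y \<in> points X" "x = \<pi> y"
      by (auto simp: pushforward_diff_def)
    then show ?case
      unfolding pushforward_diff_def using 3(1) plot_const[OF 3(1), of y] by auto
  next
    case (4 n U f)
    have "\<exists>U' g. u \<in> U' \<and> U' \<subseteq> U \<and> plot X n U' g \<and> (\<forall>v\<in>U'. f v = \<pi> (g v))"
      if u: "u \<in> U" for u
    proof -
      from 4(2)[OF u] obtain U' g where U': "u \<in> U'" "U' \<subseteq> U"
          "plot (pushforward_diff \<pi> X) n U' g" "\<forall>v\<in>U'. f v = g v"
        by blast
      from U'(3) have "\<forall>u\<in>U'. \<exists>U'' h. u \<in> U'' \<and> U'' \<subseteq> U' \<and> plot X n U'' h \<and> (\<forall>v\<in>U''. g v = \<pi> (h v))"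
        by (simp add: pushforward_diff_def)
      with U'(1) obtain U'' h where "u \<in> U''" "U'' \<subseteq> U'" "plot X n U'' h" "\<forall>v\<in>U''. g v = \<pi> (h v)"
        by blast
      with U' show ?thesis
        by (intro exI[of _ U''] exI[of _ h]) auto
    qed
    with 4(1) show ?case
      by (simp add: pushforward_diff_def)
  next
    case (5 n U f m V \<phi>)
    have "\<exists>V' g. v \<in> V' \<and> V' \<subseteq> V \<and> plot X m V' g \<and> (\<forall>w\<in>V'. (f \<circ> \<phi>) w = \<pi> (g w))"
      if "v \<in> V" for v
    proof -
      from 5(3) that have "\<phi> v \<in> U" by (auto simp: smooth_between_def)
      moreover from 5(1) have
        "\<forall>u\<in>U. \<exists>U' g. u \<in> U' \<and> U' \<subseteq> U \<and> plot X n U' g \<and> (\<forall>w\<in>U'. f w = \<pi> (g w))"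
        by (simp add: pushforward_diff_def)
      ultimately obtain U' g
        where U': "\<phi> v \<in> U'" "U' \<subseteq> U" "plot X n U' g" "\<forall>w\<in>U'. f w = \<pi> (g w)"
        by blast
      define V' where "V' = {w \<in> V. \<phi> w \<in> U'}"
      have "openin (Euclidean_space n) U"
        using 5(1) by (simp add: pushforward_diff_def)
      then have "openin (Euclidean_space m) V'"
        unfolding V'_def using openin_smooth_vimage[OF 5(3,2)] plot_domain[OF U'(3)] by blast
      moreover have "smooth_between m V' n U' \<phi>"
        using 5(3) smooth_on_subset[of m V _ V']
        by (auto simp: smooth_between_def V'_def)
      ultimately have "plot X m V' (g \<circ> \<phi>)"
        by (rule plot_compose[OF U'(3)])
      then show ?thesis
        using that U'(1,4) by (intro exI[of _ V'] exI[of _ "g \<circ> \<phi>"]) (auto simp: V'_def)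
    qed
    with 5(2) show ?case
      by (simp add: pushforward_diff_def)
  qed
qed

lemma diffeological_space_Spl:
  assumes "diffeological_space DA" "points DA = carrier A"
  shows "diffeological_space (Spl A DA act)"
  unfolding Spl_def PA_def subset_diff_def
  using assms
  by (auto intro!: diffeological_space_pushforward_diff diffeological_space_induced_diff)

lemma diffeological_space_Gr_rel:
  assumes "diffeological_space DA" "points DA = carrier A"
  shows "diffeological_space (Gr_rel A DA act V1)"
  unfolding Gr_rel_def
  using diffeological_space_Spl[OF assms] by (auto intro!: diffeological_space_induced_diff)


section \<open>The constant family at the identity\<close>

text \<open>
  A map on \<open>X\<close> matters only through its values at the points of \<open>X\<close>, so the identity map is
  represented by any function that fixes all points, for example by its restriction.
\<close>

lemma smooth_cong_id:
  assumes "diffeological_space X" "\<And>x. x \<in> points X \<Longrightarrow> f x = x"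
  shows "smooth X X f"
proof -
  interpret diffeological_space X by fact
  have "plot X n U (f \<circ> c)" if "plot X n U c" for n U c
    using that
  proof (rule plot_cong)
    show "(f \<circ> c) u = c u" if "u \<in> U" for u
      using plot_into[OF \<open>plot X n U c\<close>] that assms(2) by auto
  qed
  then show ?thesis
    using assms(2) by (auto simp: smooth_def)
qed

lemma inv_into_cong_id:
  assumes "\<And>x. x \<in> S \<Longrightarrow> f x = x" "x \<in> S"
  shows "inv_into S f x = x"
  using assms by (metis inv_into_f_f inj_onI)

lemma diffeomorphism_cong_id:
  assumes "diffeological_space X" "\<And>x. x \<in> points X \<Longrightarrow> f x = x"
  shows "diffeomorphism X X f"
proof -
  have "bij_betw f (points X) (points X)"
    using assms(2) by (auto simp: bij_betw_def inj_on_def)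
  moreover have "smooth X X f" "smooth X X (inv_into (points X) f)"
    using assms inv_into_cong_id[OF assms(2)] by (auto intro: smooth_cong_id)
  ultimately show ?thesis
    by (simp add: diffeomorphism_def)
qed

text \<open>
  Evaluating the constant family at the identity on a plot \<open>c\<close> gives \<open>c\<close> composed with the
  projection of the product domain onto its first factor, which is again a plot.
\<close>

lemma plot_functional_diff_const_id:
  assumes "diffeological_space X" "openin (Euclidean_space n) U"
    and "\<And>u. u \<in> U \<Longrightarrow> g u = restrict (\<lambda>x. x) (points X)"
  shows "plot (functional_diff X X) n U g"
proof -
  interpret diffeological_space X by fact
  have "plot X (m + n) (prod_domain m V n U) (\<lambda>z. g (snd_part m z) (c (fst_part m z)))"
    if c: "plot X m V c" for m V c
  proof (rule plot_cong)
    show "plot X (m + n) (prod_domain m V n U) (c \<circ> fst_part m)"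
      using c plot_domain[OF c] assms(2) smooth_between_fst_part openin_prod_domain
      by (intro plot_compose)
    fix z assume "z \<in> prod_domain m V n U"
    then show "g (snd_part m z) (c (fst_part m z)) = (c \<circ> fst_part m) z"
      using plot_into[OF c] assms(3) by (auto simp: prod_domain_def)
  qed
  moreover have "smooth X X (restrict (\<lambda>x. x) (points X))"
    using assms(1) by (rule smooth_cong_id) simp
  ultimately show ?thesis
    using assms(2,3) by (auto simp: functional_diff_def)
qed

lemma plot_Diff_const_id:
  assumes "diffeological_space X" "openin (Euclidean_space n) U"
    and "\<And>u. u \<in> U \<Longrightarrow> g u = restrict (\<lambda>x. x) (points X)"
  shows "plot (Diff X) n U g"
proof -
  have "restrict (inv_into (points X) (g u)) (points X) = restrict (\<lambda>x. x) (points X)"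
    if "u \<in> U" for u
    using assms(3)[OF that] by (intro restrict_ext inv_into_cong_id) auto
  then have "plot (functional_diff X X) n U (\<lambda>u. restrict (inv_into (points X) (g u)) (points X))"
    using assms(1,2) by (intro plot_functional_diff_const_id)
  moreover have "plot (functional_diff X X) n U g"
    using assms by (rule plot_functional_diff_const_id)
  moreover have "diffeomorphism X X (restrict (\<lambda>x. x) (points X))"
    using assms(1) by (rule diffeomorphism_cong_id) simp
  ultimately show ?thesis
    using assms(3) by (auto simp: Diff_def)
qed


section \<open>Cancellation of the two operators\<close>

lemma proj_unique:
  assumes "Modules.additive P" "\<And>x. P (P x) = P x"
  shows "proj (range P, {x. P x = 0}) = P"
proof
  interpret Modules.additive P by fact
  fix x
  have "(THE v. v \<in> range P \<and> (\<exists>w\<in>{x. P x = 0}. x = v + w)) = P x"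
  proof (rule the_equality)
    show "P x \<in> range P \<and> (\<exists>w\<in>{x. P x = 0}. x = P x + w)"
      by (intro conjI rangeI bexI[of _ "x - P x"]) (auto simp: diff assms(2))
  qed (auto simp: add assms(2))
  then show "proj (range P, {x. P x = 0}) x = P x"
    by (simp add: proj_def)
qed

lemma same_range_absorb:
  assumes "range P = range Q" "\<And>x. Q (Q x) = Q x"
  shows "Q (P y) = P y"
proof -
  have "P y \<in> range Q" using assms(1) by blast
  then show ?thesis using assms(2) by auto
qed

lemma same_kernel_absorb:
  assumes "{x. P x = 0} = {x. Q x = 0}" "\<And>x. P (P x) = P x"
    and "Modules.additive P" "Modules.additive Q"
  shows "Q (P y) = Q y"
proof -
  have "P (y - P y) = 0"
    using assms(2,3) by (simp add: Modules.additive.diff)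
  then have "Q (y - P y) = 0"
    using assms(1) by blast
  then show ?thesis
    using assms(4) by (simp add: Modules.additive.diff)
qed

lemma proj_swap:
  assumes "Modules.additive P" "\<And>x. P (P x) = P x"
  shows "proj ({x. P x = 0}, range P) = (\<lambda>x. x - P x)"
proof -
  interpret Modules.additive P by fact
  have "range (\<lambda>x. x - P x) = {x. P x = 0}"
  proof
    show "{x. P x = 0} \<subseteq> range (\<lambda>x. x - P x)"
      by (metis (mono_tags, lifting) diff_zero mem_Collect_eq rangeI subsetI)
  qed (auto simp: diff assms(2))
  moreover have "{x. x - P x = 0} = range P"
    by (auto simp: assms(2) image_iff)
  moreover have "Modules.additive (\<lambda>x. x - P x)"
    by unfold_locales (simp add: add)
  ultimately show ?thesis
    using proj_unique[of "\<lambda>x. x - P x"] by (simp add: diff assms(2))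
qed

text \<open>
  The idempotent of the algebra that represents a splitting need not be unique, as the action may
  have a kernel; the operator by which it acts is the projection determined by the splitting.
\<close>

lemma points_Spl_projection:
  fixes scale :: "'k::real_normed_field \<Rightarrow> 'e::ab_group_add \<Rightarrow> 'e"
  assumes "diffeological_algebra_action scale E A DA act"
    and "(V, W) \<in> points (Spl A DA act)"
  obtains P where "Modules.additive P" "\<And>x. P (P x) = P x" "V = range P" "W = {x. P x = 0}"
proof -
  interpret diffeological_algebra_action scale E A DA act by fact
  from assms(2) obtain p where p: "p \<in> carrier A" "p \<otimes>\<^bsub>A\<^esub> p = p"
      "V = range (act p)" "W = {x. act p x = 0}"
    by (auto simp: Spl_def PA_def subset_diff_def induced_diff_def pushforward_diff_def
        Im_act_def Ker_act_def)
  interpret Vector_Spaces.linear scale scale "act p"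
    using p(1) by (rule act_linear)
  show ?thesis
  proof
    show "Modules.additive (act p)" by unfold_locales (rule add)
    show "act p (act p x) = act p x" for x
      using act_mult[of p p x] p by simp
  qed (use p in auto)
qed

text \<open>
  The right-hand side is \<open>1 - (b - c)\<^sup>2\<close> at \<open>x\<close>. The projection \<open>a\<close> disappears: \<open>ca = c\<close> because
  \<open>a\<close> and \<open>c\<close> have the same kernel, and \<open>(1 - b)(1 - a) = 1 - b\<close> because \<open>a\<close> and \<open>b\<close> have the same
  image, so that only \<open>bc + (1 - c)(1 - b)\<close> is left.
\<close>

lemma DVtilde_eq_one_minus_square:
  assumes additive: "Modules.additive a" "Modules.additive b" "Modules.additive c"
    and idem: "\<And>x. a (a x) = a x" "\<And>x. b (b x) = b x" "\<And>x. c (c x) = c x"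
    and "V1 = range a" "W1 = {x. a x = 0}" "V1 = range b" "W2 = {x. b x = 0}"
      "V2 = range c" "W1 = {x. c x = 0}"
  shows "DVtilde ((V1, W1), (V2, W2)) x = x - b x - c x + b (c x) + c (b x)"
proof -
  interpret a: Modules.additive a by fact
  interpret b: Modules.additive b by fact
  interpret c: Modules.additive c by fact
  have a: "proj (V1, W1) = a" "proj (W1, V1) = (\<lambda>x. x - a x)"
    using proj_unique[of a] proj_swap[of a] assms by simp_all
  have b: "proj (V1, W2) = b" "proj (W2, V1) = (\<lambda>x. x - b x)"
    unfolding \<open>V1 = range b\<close> \<open>W2 = {x. b x = 0}\<close>
    using proj_unique[of b] proj_swap[of b] additive(2) idem(2) by simp_all
  have c: "proj (V2, W1) = c" "proj (W1, V2) = (\<lambda>x. x - c x)"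
    unfolding \<open>V2 = range c\<close> \<open>W1 = {x. c x = 0}\<close>
    using proj_unique[of c] proj_swap[of c] additive(3) idem(3) by simp_all
  have "b (a y) = a y" "c (a y) = c y" for y
    using same_range_absorb[of a b] same_kernel_absorb[of a c] assms by simp_all
  \<comment> \<open>\<open>DV\<close> is a restriction to \<open>V1\<close>, respectively \<open>W1\<close>, and is evaluated at these points.\<close>
  moreover have "a x \<in> V1" "x - a x \<in> W1"
    unfolding \<open>V1 = range a\<close> \<open>W1 = {x. a x = 0}\<close> by (simp_all add: a.diff idem)
  ultimately show ?thesis
    by (simp add: DVtilde_def Phi_def DV_def a b c b.diff c.diff idem)
qed

text \<open>
  Expand \<open>(1 - (b - c)\<^sup>2)(1 - (a - d)\<^sup>2)\<close>: every product of one of \<open>b\<close>, \<open>c\<close> with one of \<open>a\<close>, \<open>d\<close>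
  collapses to a single projection, since the two share their image or their kernel, and the
  resulting terms cancel down to \<open>1\<close>.
\<close>

lemma Xi_eq_id:
  fixes scale :: "'k::real_normed_field \<Rightarrow> 'e::ab_group_add \<Rightarrow> 'e"
  assumes "diffeological_algebra_action scale E A DA act"
    and "((V1, W1), (V2, W2)) \<in> points (Adm A DA act)"
  shows "Xi ((V1, W1), (V2, W2)) = id"
proof
  fix x
  have spl: "(V1, W1) \<in> points (Spl A DA act)" "(V2, W2) \<in> points (Spl A DA act)"
    "(V1, W2) \<in> points (Spl A DA act)" "(V2, W1) \<in> points (Spl A DA act)"
    using assms(2)
    by (auto simp: Adm_def Let_def subset_diff_def induced_diff_def prod_diff_def)
  obtain a where a: "Modules.additive a" "\<And>x. a (a x) = a x" "V1 = range a" "W1 = {x. a x = 0}"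
    by (rule points_Spl_projection[OF assms(1) spl(1)]) (rule that)
  obtain b where b: "Modules.additive b" "\<And>x. b (b x) = b x" "V1 = range b" "W2 = {x. b x = 0}"
    by (rule points_Spl_projection[OF assms(1) spl(3)]) (rule that)
  obtain c where c: "Modules.additive c" "\<And>x. c (c x) = c x" "V2 = range c" "W1 = {x. c x = 0}"
    by (rule points_Spl_projection[OF assms(1) spl(4)]) (rule that)
  obtain d where d: "Modules.additive d" "\<And>x. d (d x) = d x" "V2 = range d" "W2 = {x. d x = 0}"
    by (rule points_Spl_projection[OF assms(1) spl(2)]) (rule that)
  interpret a: Modules.additive a by fact
  interpret b: Modules.additive b by fact
  interpret c: Modules.additive c by fact
  interpret d: Modules.additive d by fact
  have "b (a y) = a y" "d (c y) = c y" "c (d y) = d y" for y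
    using same_range_absorb[of a b] same_range_absorb[of c d] same_range_absorb[of d c] a b c d
    by simp_all
  moreover have "c (a y) = c y" "b (d y) = b y" for y
    using same_kernel_absorb[of a c] same_kernel_absorb[of d b] a b c d by simp_all
  moreover have "DVtilde ((V1, W2), (V2, W1)) x = x - a x - d x + a (d x) + d (a x)"
    using a b d by (intro DVtilde_eq_one_minus_square) auto
  moreover have "DVtilde ((V1, W1), (V2, W2)) y = y - b y - c y + b (c y) + c (b y)" for y
    using a b c by (intro DVtilde_eq_one_minus_square) auto
  ultimately show "Xi ((V1, W1), (V2, W2)) x = id x"
    by (simp add: Xi_def b.add b.diff c.add c.diff a(2) b(2) c(2) d(2))
qed


section \<open>The action on the relative Grassmannian\<close>

theorem theorem42:
  fixes scale :: "'k::real_normed_field \<Rightarrow> 'e::ab_group_add \<Rightarrow> 'e"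
    and E :: "'e diffeology"
    and A :: "('k, 'a) module"
    and DA :: "'a diffeology"
    and act :: "'a \<Rightarrow> 'e \<Rightarrow> 'e"
    and V1 :: "'e set"
  assumes "diffeological_algebra_action scale E A DA act"
    and "V1 \<in> points (Gr A DA act)"
  shows "(\<forall>W1 \<in> points (Gr A DA act). \<forall>V2 \<in> points (Gr A DA act). \<forall>W2 \<in> points (Gr A DA act).
            ((V1, W1), (V2, W2)) \<in> points (Adm A DA act) \<longrightarrow>
            diffeomorphism (Gr_rel A DA act V1) (Gr_rel A DA act V1)
              (\<lambda>W. Xi ((V1, W1), (V2, W2)) ` W)) \<and>
         smooth (D_rel A DA act V1) (Diff (Gr_rel A DA act V1))
           (\<lambda>(W1, V2, W2).
              restrict (\<lambda>W. Xi ((V1, W1), (V2, W2)) ` W) (points (Gr_rel A DA act V1)))"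
proof -
  interpret diffeological_algebra_action scale E A DA act by fact
  let ?G = "Gr_rel A DA act V1"
  have G: "diffeological_space ?G"
    using alg.diffeological_space_axioms alg.points_carrier by (rule diffeological_space_Gr_rel)
  have id: "Xi ((V1, W1), (V2, W2)) ` W = W"
    if "((V1, W1), (V2, W2)) \<in> points (Adm A DA act)" for W1 V2 W2 W
    using Xi_eq_id[OF assms(1) that] by simp
  let ?F = "\<lambda>(W1, V2, W2). restrict (\<lambda>W. Xi ((V1, W1), (V2, W2)) ` W) (points ?G)"
  have F: "?F t = restrict (\<lambda>W. W) (points ?G)" if "t \<in> points (D_rel A DA act V1)" for t
  proof -
    from that obtain W1 V2 W2
      where t: "t = (W1, V2, W2)" and adm: "((V1, W1), (V2, W2)) \<in> points (Adm A DA act)"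
      by (auto simp: D_rel_def induced_diff_def)
    show ?thesis
      unfolding t prod.case by (rule restrict_ext) (rule id[OF adm])
  qed
  have "smooth (D_rel A DA act V1) (Diff ?G) ?F"
    unfolding smooth_def
  proof (intro conjI allI impI)
    show "?F ` points (D_rel A DA act V1) \<subseteq> points (Diff ?G)"
    proof
      fix f assume "f \<in> ?F ` points (D_rel A DA act V1)"
      then have "f = restrict (\<lambda>W. W) (points ?G)"
        using F by blast
      moreover have "diffeomorphism ?G ?G (restrict (\<lambda>W. W) (points ?G))"
        using G by (rule diffeomorphism_cong_id) simp
      ultimately show "f \<in> points (Diff ?G)"
        by (simp add: Diff_def)
    qed
  next
    fix n U c
    assume c: "plot (D_rel A DA act V1) n U c"
    then have "plot (Spl A DA act) n U
        (fst \<circ> ((\<lambda>(W1, V2, W2). ((V1, W1), (V2, W2))) \<circ> c))"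
      by (simp add: D_rel_def Adm_def Let_def subset_diff_def induced_diff_def prod_diff_def comp_def)
    then have "openin (Euclidean_space n) U"
      by (simp add: Spl_def pushforward_diff_def)
    moreover have "(?F \<circ> c) u = restrict (\<lambda>W. W) (points ?G)" if "u \<in> U" for u
    proof -
      have "c u \<in> points (D_rel A DA act V1)"
        using c that by (auto simp: D_rel_def induced_diff_def)
      then show ?thesis
        using F by simp
    qed
    ultimately show "plot (Diff ?G) n U (?F \<circ> c)"
      using G by (intro plot_Diff_const_id)
  qed
  moreover have "diffeomorphism ?G ?G (\<lambda>W. Xi ((V1, W1), (V2, W2)) ` W)"
    if "((V1, W1), (V2, W2)) \<in> points (Adm A DA act)" for W1 V2 W2
    using id[OF that] by (intro diffeomorphism_cong_id[OF G])
  ultimately show ?thesis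
    by blast
qed

end
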